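(* Let $\mathcal{A}$ be a regular Rickart *-ring, and let $\preceq^{\alpha}$ be any of the nine partial orders with $\alpha\in\{r*|\ell\square,\ r*|r\square,\ r*|\square,\ \ell*|\ell\square,\ \ell*|r\square,\ \ell*|\square,\ *|\ell\square,\ *|r\square,\ *|\square\}$. If $a_1,a_2,b\in\mathcal{A}$ satisfy $a_1\preceq^{\alpha}b$ and $a_2\preceq^{\alpha}b$, then both the supremum $a_1\vee a_2$ and the infimum $a_1\wedge a_2$ of $\{a_1,a_2\}$ exist in $(\mathcal{A},\preceq^{\alpha})$. Moreover, $$a_1\vee a_2=b(\mathrm{rp}(a_1)\vee\mathrm{rp}(a_2))=b(a_1^\dagger a_1\vee a_2^\dagger a_2),\qquad a_1\wedge a_2=b(\mathrm{rp}(a_1)\wedge\mathrm{rp}(a_2))=b(a_1^\dagger a_1\wedge a_2^\dagger a_2)$$ whenever $\alpha\in\{r*|\ell\square,\ r*|r\square,\ r*|\square,\ *|\ell\square,\ *|r\square,\ *|\square\}$, while $$a_1\vee a_2=(\mathrm{lp}(a_1)\vee\mathrm{lp}(a_2))b=(a_1a_1^\dagger\vee a_2a_2^\dagger)b,\qquad a_1\wedge a_2=(\mathrm{lp}(a_1)\wedge\mathrm{lp}(a_2))b=(a_1a_1^\dagger\wedge a_2a_2^\dagger)b$$ whenever $\alpha\in\{\ell*|\ell\square,\ \ell*|r\square,\ \ell*|\square\}$. (On the right-hand sides, $\vee$ and $\wedge$ are taken in the lattice $E(\mathcal{A})$.)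
   Context: A *-ring is an (associative) ring $\mathcal{A}$ with an involution $*$: $(a+b)^*=a^*+b^*$, $(ab)^*=b^*a^*$, $(a^* )^*=a$. It is a Rickart *-ring if for every $a\in\mathcal{A}$ there is a self-adjoint idempotent $p$ (i.e. $p=p^*=p^2$) with $\{x\in\mathcal{A}: xa=0\}=\mathcal{A}(1-p)$; such a ring has an identity $1$, and $p$ is unique and denoted $\mathrm{lp}(a)$. Likewise, for every $a$ there is a unique self-adjoint idempotent $\mathrm{rp}(a)$ with $\{x\in\mathcal{A}: ax=0\}=(1-\mathrm{rp}(a))\mathcal{A}$. The ring is regular if for every $a\in\mathcal{A}$ there is $a^-\in\mathcal{A}$ with $aa^-a=a$. In a regular Rickart *-ring every $a$ has a (unique) Moore–Penrose inverse $a^\dagger$: $aa^\dagger a=a$, $a^\dagger aa^\dagger=a^\dagger$, $(aa^\dagger)^*=aa^\dagger$, $(a^\dagger a)^*=a^\dagger a$. $E(\mathcal{A})$ is the set of self-adjoint idempotents, partially ordered by $p\le q$ iff $p=pq$; it is known to be a lattice. Base relations: $a\preceq^{r*} b$ iff $a\,\mathrm{rp}(b)=a=b\,\mathrm{rp}(a)$; $a\preceq^{\ell*} b$ iff $\mathrm{lp}(a)b=a=\mathrm{lp}(b)a$; $a\preceq^{*} b$ iff $\mathrm{lp}(a)b=a=b\,\mathrm{rp}(a)$. For $\beta\in\{r*,\ell*,*\}$: $a\preceq^{\beta|\ell\square} b$ iff $a\preceq^{\beta}b$ and $a^2=ab$; $a\preceq^{\beta|r\square} b$ iff $a\preceq^{\beta}b$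 and $a^2=ba$; $a\preceq^{\beta|\square} b$ iff $a\preceq^{\beta}b$ and $a^2=ab=ba$. All of these are partial orders on $\mathcal{A}$. *)

theory Defs
  imports "HOL-Algebra.Lattice"
begin

section \<open>Regular Rickart *-rings\<close>

text \<open>Unital associative rings with involution. The axiom \<open>0 \<noteq> 1\<close> of \<^class>\<open>ring_1\<close> is
  deliberately not imposed, so that the zero ring is included.\<close>

class star_ring = ring + monoid_mult +
  fixes star :: "'a \<Rightarrow> 'a"
  assumes star_add: "star (a + b) = star a + star b"
    and star_mult: "star (a * b) = star b * star a"
    and star_star: "star (star a) = a"

definition projections :: "'a::star_ring set" where
  "projections = {p. p = star p \<and> p = p * p}"

class rickart_star_ring = star_ring +
  assumes rickart: "\<exists>p. p = star p \<and> p = p * p \<and> {x. x * a = 0} = {y * (1 - p) | y. True}"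

class regular_rickart_star_ring = rickart_star_ring +
  assumes regular: "\<exists>x. a * x * a = a"

definition lp :: "'a::rickart_star_ring \<Rightarrow> 'a" where
  "lp a = (THE p. p \<in> projections \<and> {x. x * a = 0} = {y * (1 - p) | y. True})"

definition rp :: "'a::rickart_star_ring \<Rightarrow> 'a" where
  "rp a = (THE p. p \<in> projections \<and> {x. a * x = 0} = {(1 - p) * y | y. True})"

definition is_mp_inverse :: "'a::star_ring \<Rightarrow> 'a \<Rightarrow> bool" where
  "is_mp_inverse a x \<longleftrightarrow>
     a * x * a = a \<and> x * a * x = x \<and> star (a * x) = a * x \<and> star (x * a) = x * a"

definition mp_inverse :: "'a::regular_rickart_star_ring \<Rightarrow> 'a"  (\<open>_\<^sup>\<dagger>\<close> [1000] 999) where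
  "a\<^sup>\<dagger> = (THE x. is_mp_inverse a x)"

definition proj_order :: "'a::star_ring gorder" where
  "proj_order = \<lparr>carrier = projections, eq = (=), le = (\<lambda>p q. p = p * q)\<rparr>"


section \<open>The nine orders\<close>

datatype base = Right_star | Left_star | Star

datatype side = Left_square | Right_square | Square

fun base_le :: "base \<Rightarrow> 'a::rickart_star_ring \<Rightarrow> 'a \<Rightarrow> bool" where
  "base_le Right_star a b \<longleftrightarrow> a * rp b = a \<and> a = b * rp a"
| "base_le Left_star a b \<longleftrightarrow> lp a * b = a \<and> a = lp b * a"
| "base_le Star a b \<longleftrightarrow> lp a * b = a \<and> a = b * rp a"

fun side_cond :: "side \<Rightarrow> 'a::rickart_star_ring \<Rightarrow> 'a \<Rightarrow> bool" where
  "side_cond Left_square a b \<longleftrightarrow> a\<^sup>2 = a * b"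
| "side_cond Right_square a b \<longleftrightarrow> a\<^sup>2 = b * a"
| "side_cond Square a b \<longleftrightarrow> a\<^sup>2 = a * b \<and> a * b = b * a"

definition star_order :: "base \<Rightarrow> side \<Rightarrow> 'a::rickart_star_ring gorder" where
  "star_order \<beta> \<sigma> =
     \<lparr>carrier = UNIV, eq = (=), le = (\<lambda>a b. base_le \<beta> a b \<and> side_cond \<sigma> a b)\<rparr>"


section \<open>Well-definedness\<close>

lemma projection_unique_left:
  fixes p q :: "'a::star_ring"
  assumes p: "p \<in> projections" and q: "q \<in> projections"
    and eq: "{y * (1 - p) | y. True} = {y * (1 - q) | y. True}"
  shows "p = q"
proof -
  have "1 - p \<in> {y * (1 - q) | y. True}" unfolding eq[symmetric] by (rule CollectI, rule exI[of _ 1]) simp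
  then obtain u where u: "1 - p = u * (1 - q)" by blast
  have "1 - q \<in> {y * (1 - p) | y. True}" unfolding eq by (rule CollectI, rule exI[of _ 1]) simp
  then obtain v where v: "1 - q = v * (1 - p)" by blast
  have sp: "star p = p" "p * p = p" and sq: "star q = q" "q * q = q"
    using p q by (auto simp: projections_def)
  have "(1 - p) * q = u * ((1 - q) * q)" by (simp add: u mult.assoc)
  then have 1: "q = p * q" using sq by (simp add: algebra_simps)
  have "(1 - q) * p = v * ((1 - p) * p)" by (simp add: v mult.assoc)
  then have 2: "p = q * p" using sp by (simp add: algebra_simps)
  have "star q = star (p * q)" using 1 by simp
  then have "q = q * p" by (simp add: star_mult sp sq)
  with 2 show ?thesis by simp
qed

lemma star_zero [simp]: "star (0::'a::star_ring) = 0"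
  using star_add[of "0::'a" 0] by simp

lemma star_one [simp]: "star (1::'a::star_ring) = 1"
  using star_mult[of "star (1::'a)" 1] by (simp add: star_star)

lemma star_diff: "star (a - b) = star a - star (b::'a::star_ring)"
  using star_add[of "a - b" b] by (simp add: algebra_simps)

lemma star_left_set:
  fixes p :: "'a::star_ring"
  assumes p: "star p = p"
  shows "{x. x * star a = 0} = {y * (1 - p) | y. True} \<longleftrightarrow>
         {x. a * x = 0} = {(1 - p) * y | y. True}"
proof -
  have zero: "x * star a = 0 \<longleftrightarrow> a * star x = 0" for x
  proof -
    have "star (x * star a) = a * star x" by (simp add: star_mult star_star)
    then show ?thesis by (metis star_star star_zero)
  qed
  have range: "(\<exists>y. x = y * (1 - p)) \<longleftrightarrow> (\<exists>y. star x = (1 - p) * y)" for x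
  proof -
    have "star (y * (1 - p)) = (1 - p) * star y" "star ((1 - p) * y) = star y * (1 - p)" for y
      by (simp_all add: star_mult star_diff p)
    then show ?thesis by (metis star_star)
  qed
  have "{x. x * star a = 0} = {y * (1 - p) | y. True} \<longleftrightarrow>
        (\<forall>x. a * star x = 0 \<longleftrightarrow> (\<exists>y. star x = (1 - p) * y))"
    by (simp add: set_eq_iff zero range)
  also have "\<dots> \<longleftrightarrow> (\<forall>x. a * x = 0 \<longleftrightarrow> (\<exists>y. x = (1 - p) * y))"
    by (rule iffI; rule allI) (metis star_star)+
  finally show ?thesis by (simp add: set_eq_iff)
qed

lemma lp_ex1:
  "\<exists>!p. p \<in> projections \<and> {x. x * a = 0} = {y * (1 - p) | y. True}"
  for a :: "'a::rickart_star_ring"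
proof -
  obtain p where "p \<in> projections" "{x. x * a = 0} = {y * (1 - p) | y. True}"
    using rickart[of a] by (auto simp: projections_def)
  then show ?thesis using projection_unique_left by (intro ex1I[of _ p]) auto
qed

lemma rp_ex1:
  "\<exists>!p. p \<in> projections \<and> {x. a * x = 0} = {(1 - p) * y | y. True}"
  for a :: "'a::rickart_star_ring"
proof -
  have "p \<in> projections \<and> {x. a * x = 0} = {(1 - p) * y | y. True} \<longleftrightarrow>
        p \<in> projections \<and> {x. x * star a = 0} = {y * (1 - p) | y. True}" for p
  proof (cases "p \<in> projections")
    case True
    then have "star p = p" by (simp add: projections_def)
    then show ?thesis using True star_left_set[of p a] by simp
  qed simp
  then show ?thesis using lp_ex1[of "star a"] by simp
qed

lemma is_mp_inverse_unique:
  fixes a :: "'a::star_ring"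
  assumes x: "is_mp_inverse a x" and y: "is_mp_inverse a y"
  shows "x = y"
proof -
  have ax: "a * x = a * y"
  proof -
    have "a * x = star (a * x)" using x by (simp add: is_mp_inverse_def)
    also have "\<dots> = star ((a * y) * (a * x))"
      using y by (simp add: is_mp_inverse_def mult.assoc[symmetric])
    also have "\<dots> = (a * x) * (a * y)"
      using x y by (simp only: star_mult[of "a * y"] is_mp_inverse_def)
    also have "\<dots> = a * y" using x by (simp add: is_mp_inverse_def mult.assoc[symmetric])
    finally show ?thesis .
  qed
  have xa: "x * a = y * a"
  proof -
    have "x * a = star (x * a)" using x by (simp add: is_mp_inverse_def)
    also have "\<dots> = star ((x * a) * (y * a))"
      using y by (simp add: is_mp_inverse_def mult.assoc)
    also have "\<dots> = (y * a) * (x * a)"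
      using x y by (simp only: star_mult[of "x * a"] is_mp_inverse_def)
    also have "\<dots> = y * a" using x by (simp add: is_mp_inverse_def mult.assoc)
    finally show ?thesis .
  qed
  have "x = x * a * x" using x by (simp add: is_mp_inverse_def)
  also have "\<dots> = y * (a * x)" using xa by (simp add: mult.assoc)
  also have "\<dots> = y * a * y" using ax by (simp add: mult.assoc)
  also have "\<dots> = y" using y by (simp add: is_mp_inverse_def)
  finally show ?thesis .
qed

lemma mp_inverse_ex1: "\<exists>!x. is_mp_inverse a x"
  for a :: "'a::regular_rickart_star_ring"
proof -
  obtain u where u: "a * u * a = a" using regular by blast
  obtain p where p: "p \<in> projections" "{x. x * a = 0} = {y * (1 - p) | y. True}"
    using lp_ex1[of a] by blast
  obtain q where q: "q \<in> projections" "{x. a * x = 0} = {(1 - q) * y | y. True}"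
    using rp_ex1[of a] by blast
  have pp: "star p = p" "p * p = p" and qq: "star q = q" "q * q = q"
    using p q by (auto simp: projections_def)
  have "1 - p \<in> {x. x * a = 0}" unfolding p(2) by (rule CollectI, rule exI[of _ 1]) simp
  then have pa: "p * a = a" by (simp add: algebra_simps)
  have "1 - q \<in> {x. a * x = 0}" unfolding q(2) by (rule CollectI, rule exI[of _ 1]) simp
  then have aq: "a * q = a" by (simp add: algebra_simps)
  have "1 - a * u \<in> {x. x * a = 0}" using u by (simp add: algebra_simps)
  then obtain y where y: "1 - a * u = y * (1 - p)" unfolding p(2) by blast
  have "(1 - a * u) * p = y * ((1 - p) * p)" by (simp add: y mult.assoc)
  then have aup: "a * (u * p) = p" using pp by (simp add: algebra_simps)
  have "1 - u * a \<in> {x. a * x = 0}" using u by (simp add: algebra_simps)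
  then obtain z where z: "1 - u * a = (1 - q) * z" unfolding q(2) by blast
  have "q * (1 - u * a) = (q * (1 - q)) * z" by (simp add: z mult.assoc)
  then have qua: "q * (u * a) = q" using qq by (simp add: algebra_simps)
  define x where "x = q * (u * p)"
  have ax: "a * x = p" unfolding x_def using aq aup by (metis mult.assoc)
  have xa: "x * a = q" unfolding x_def using pa qua by (simp add: mult.assoc)
  have "x * a * x = x" unfolding xa using qq unfolding x_def by (metis mult.assoc)
  then have "is_mp_inverse a x"
    unfolding is_mp_inverse_def using ax xa pa pp qq by simp
  then show ?thesis using is_mp_inverse_unique by blast
qed

end

(* For the bases r* and *, the map a |-> rp(a) embeds the elements below b into the
   projections below rp(b), with inverse p |-> b p. Its image consists of the projections p with
   p h = p h p for every h in a finite set depending only on b and the order, and this condition is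
   inherited by p \<or> q and p \<and> q because p h (1 - p) = 0 is an annihilator
   condition. Hence a1 and a2 have a supremum and an infimum below b. Any other upper bound c
   satisfies (c - b) rp(ai) = 0, so c and b agree on rp(a1) \<or> rp(a2), and the supremum below b
   is the supremum in the whole ring. The base l* reduces to r* by applying the involution. *)

theory Submission
  imports Defs
begin

section \<open>Projections\<close>

lemma projectionsD:
  assumes "p \<in> projections"
  shows "star p = p" "p * p = p"
  using assms by (auto simp: projections_def)

lemma projections_complement:
  "p \<in> projections \<Longrightarrow> 1 - p \<in> projections"
  by (simp add: projections_def star_diff algebra_simps)

lemma projections_mult_complement:
  assumes "p \<in> projections"
  shows "p * ((1 - p) * x) = 0"
proof -
  have "p * (1 - p) = 0" by (simp add: right_diff_distrib projectionsD[OF assms])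
  then show ?thesis by (simp flip: mult.assoc)
qed

lemma star_cancel: "star a = star b \<longleftrightarrow> a = b"
  by (metis star_star)

lemma projections_le_sym:
  assumes "p \<in> projections" "q \<in> projections"
  shows "p * q = p \<longleftrightarrow> q * p = p"
  using assms by (metis projectionsD(1) star_mult)

section \<open>Right projections and right annihilators\<close>

lemma rp_projection [simp]: "rp a \<in> projections"
  and rp_annihilator: "{x. a * x = 0} = {(1 - rp a) * y | y. True}"
  using theI'[OF rp_ex1[of a]] by (auto simp: rp_def)

lemma rp_idem [simp]: "rp a * rp a = rp a" and star_rp [simp]: "star (rp a) = rp a"
  using projectionsD[OF rp_projection] by auto

text \<open>For a projection \<open>p\<close>, \<open>p * x = 0\<close> holds exactly when
  \<open>x\<close> has the form \<open>(1 - p) * y\<close>, so equal right annihilators are what the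
  definition of \<open>rp a\<close> asks for.\<close>

lemma rp_eqI:
  assumes p: "p \<in> projections" and ann: "\<And>x. a * x = 0 \<longleftrightarrow> p * x = 0"
  shows "rp a = p"
proof -
  have "p * x = 0 \<longleftrightarrow> (\<exists>y. x = (1 - p) * y)" for x
  proof
    assume "p * x = 0"
    then have "x = (1 - p) * x" by (simp add: algebra_simps)
    then show "\<exists>y. x = (1 - p) * y" ..
  next
    assume "\<exists>y. x = (1 - p) * y"
    then show "p * x = 0"
      using projections_mult_complement[OF p] by auto
  qed
  then have "p \<in> projections \<and> {x. a * x = 0} = {(1 - p) * y | y. True}"
    using p ann by simp
  then show ?thesis unfolding rp_def by (rule the1_equality[OF rp_ex1])
qed

lemma mult_rp [simp]: "a * rp a = a"
proof -
  have "1 - rp a \<in> {x. a * x = 0}"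
    unfolding rp_annihilator by (rule CollectI, rule exI[of _ 1]) simp
  then show ?thesis by (simp add: algebra_simps)
qed

lemma rp_mult_eq_0_iff: "rp a * x = 0 \<longleftrightarrow> a * x = 0"
proof
  assume "rp a * x = 0"
  then have "a * rp a * x = 0" by (simp only: mult.assoc mult_zero_right)
  then show "a * x = 0" by simp
next
  assume "a * x = 0"
  then have "x \<in> {(1 - rp a) * y | y. True}" using rp_annihilator by blast
  then show "rp a * x = 0" by (auto simp: projections_mult_complement)
qed

text \<open>Linearity reduces this to the common right annihilator of \<open>a\<close> and
  \<open>rp a\<close>. It is the tool that later replaces left factors by projections.\<close>

lemma rp_mult_cancel: "rp a * x = rp a * y \<longleftrightarrow> a * x = a * y"
  using rp_mult_eq_0_iff[of a "x - y"] by (simp add: algebra_simps)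

lemma rp_le_iff: "rp a * q = rp a \<longleftrightarrow> a * q = a"
  using rp_mult_cancel[of a q 1] by simp

text \<open>The involution exchanges left and right annihilators, so a theory of \<open>rp\<close>
  suffices.\<close>

lemma lp_eq_rp_star: "lp a = rp (star a)"
proof -
  have "p \<in> projections \<and> {x. x * a = 0} = {y * (1 - p) | y. True} \<longleftrightarrow>
        p \<in> projections \<and> {x. star a * x = 0} = {(1 - p) * y | y. True}" for p
    using star_left_set[of p "star a"] projectionsD(1)[of p] unfolding star_star by blast
  then show ?thesis by (simp add: lp_def rp_def)
qed

section \<open>Joins and meets of two projections\<close>

text \<open>The summand \<open>rp (p * (1 - q))\<close> is the part of p \<or> q orthogonal to
  \<open>q\<close>. For operators on a Hilbert space it projects onto the closed range of
  \<open>(1 - q) * p\<close>.\<close>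

definition pjoin :: "'a::rickart_star_ring \<Rightarrow> 'a \<Rightarrow> 'a" where
  "pjoin p q = q + rp (p * (1 - q))"

definition pmeet :: "'a::rickart_star_ring \<Rightarrow> 'a \<Rightarrow> 'a" where
  "pmeet p q = 1 - pjoin (1 - p) (1 - q)"

context
  fixes p q :: "'a::rickart_star_ring"
  assumes p: "p \<in> projections" and q: "q \<in> projections"
begin

lemma rp_below_complement:
  "rp (p * (1 - q)) * q = 0" "q * rp (p * (1 - q)) = 0"
proof -
  show 1: "rp (p * (1 - q)) * q = 0"
    by (simp add: rp_mult_eq_0_iff mult.assoc) (simp add: algebra_simps projectionsD[OF q])
  show "q * rp (p * (1 - q)) = 0"
    using arg_cong[OF 1, of star] by (simp add: star_mult projectionsD[OF q])
qed

lemma pjoin_projection: "pjoin p q \<in> projections"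
  using rp_below_complement projectionsD[OF q]
  by (simp add: pjoin_def projections_def star_add algebra_simps)

lemma pjoin_upper: "p * pjoin p q = p" "q * pjoin p q = q"
proof -
  \<comment> \<open>With \<open>e = rp (p * (1 - q))\<close>, \<open>q * e = 0\<close> allows
    \<open>1 - q\<close> to be inserted before \<open>e\<close>, and then \<open>e\<close> is
    absorbed as a right projection.\<close>
  have "p * rp (p * (1 - q)) = p * (1 - q) * rp (p * (1 - q))"
    by (simp add: rp_below_complement mult.assoc left_diff_distrib del: mult_rp)
  then have "p * rp (p * (1 - q)) = p * (1 - q)" by simp
  then show "p * pjoin p q = p" by (simp add: pjoin_def algebra_simps)
  show "q * pjoin p q = q"
    by (simp add: pjoin_def distrib_left rp_below_complement projectionsD[OF q])
qed

lemma pjoin_least: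
  assumes "p * t = p" "q * t = q"
  shows "pjoin p q * t = pjoin p q"
proof -
  have "p * (1 - q) * t = p * (1 - q)" using assms by (simp add: algebra_simps)
  then have "rp (p * (1 - q)) * t = rp (p * (1 - q))" by (simp only: rp_le_iff)
  then show ?thesis by (simp add: pjoin_def distrib_right assms)
qed

text \<open>For a projection \<open>s\<close>, \<open>x * s = 0\<close> means s \<le> 1 - rp x. So
  the claim is the least upper bound property tested on \<open>1 - rp x\<close>.\<close>

lemma mult_pjoin_eq_0:
  assumes "x * p = 0" "x * q = 0"
  shows "x * pjoin p q = 0"
proof -
  have le: "s * (1 - rp x) = s \<longleftrightarrow> x * s = 0" if s: "s \<in> projections" for s
  proof -
    have "s * (1 - rp x) = s \<longleftrightarrow> s * rp x = 0" by (simp add: algebra_simps)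
    also have "\<dots> \<longleftrightarrow> rp x * s = 0"
      using star_cancel[of "s * rp x" 0] by (simp add: star_mult projectionsD[OF s])
    finally show ?thesis by (simp add: rp_mult_eq_0_iff)
  qed
  show ?thesis
    using pjoin_least[of "1 - rp x"] assms le p q pjoin_projection by simp
qed

lemma pjoin_mult_eq_0:
  assumes "p * x = 0" "q * x = 0"
  shows "pjoin p q * x = 0"
proof -
  have "star x * p = 0" "star x * q = 0"
    using assms[THEN arg_cong, of star] by (simp_all add: star_mult projectionsD p q)
  then have "star (star x * pjoin p q) = 0" by (simp add: mult_pjoin_eq_0)
  then show ?thesis by (simp add: star_mult star_star projectionsD[OF pjoin_projection])
qed

end

context
  fixes p q :: "'a::rickart_star_ring"
  assumes p: "p \<in> projections" and q: "q \<in> projections"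
begin

lemma pmeet_projection: "pmeet p q \<in> projections"
  unfolding pmeet_def by (intro projections_complement pjoin_projection p q)

lemma pmeet_lower: "pmeet p q * p = pmeet p q" "pmeet p q * q = pmeet p q"
proof -
  note c = projections_complement[OF p] projections_complement[OF q]
  note j = pjoin_projection[OF c]
  have "pjoin (1 - p) (1 - q) * (1 - p) = 1 - p" "pjoin (1 - p) (1 - q) * (1 - q) = 1 - q"
    using pjoin_upper[OF c] projections_le_sym[OF _ j] c by blast+
  then show "pmeet p q * p = pmeet p q" "pmeet p q * q = pmeet p q"
    by (simp_all add: pmeet_def algebra_simps)
qed

text \<open>\<open>x * p = x\<close> means that \<open>x\<close> annihilates \<open>1 - p\<close>,
  and annihilation passes to the join of the complements. Here \<open>x\<close> is an arbitrary ring
  element, which allows products such as \<open>m * h\<close> later.\<close>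

lemma pmeet_fix:
  assumes "x * p = x" "x * q = x"
  shows "x * pmeet p q = x"
proof -
  have "x * (1 - p) = 0" "x * (1 - q) = 0" using assms by (simp_all add: algebra_simps)
  then have "x * pjoin (1 - p) (1 - q) = 0"
    by (intro mult_pjoin_eq_0 projections_complement p q)
  then show ?thesis by (simp add: pmeet_def algebra_simps)
qed

end

text \<open>The supremum is a choice among least upper bounds; antisymmetry leaves only one
  candidate.\<close>

lemma least_antisym_eq_sup:
  assumes "least L s (Upper L {x, y})"
    and "\<And>u v. u \<in> carrier L \<Longrightarrow> v \<in> carrier L \<Longrightarrow> le L u v \<Longrightarrow> le L v u \<Longrightarrow> u = v"
  shows "x \<squnion>\<^bsub>L\<^esub> y = s"
  unfolding join_def sup_def
proof (rule some_equality)
  show "least L s (Upper L {x, y})" by (rule assms(1))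
next
  fix t assume "least L t (Upper L {x, y})"
  then show "t = s" using assms by (auto simp: least_def Upper_def)
qed

lemma greatest_antisym_eq_inf:
  assumes "greatest L s (Lower L {x, y})"
    and "\<And>u v. u \<in> carrier L \<Longrightarrow> v \<in> carrier L \<Longrightarrow> le L u v \<Longrightarrow> le L v u \<Longrightarrow> u = v"
  shows "x \<sqinter>\<^bsub>L\<^esub> y = s"
  unfolding meet_def inf_def
proof (rule some_equality)
  show "greatest L s (Lower L {x, y})" by (rule assms(1))
next
  fix t assume "greatest L t (Lower L {x, y})"
  then show "t = s" using assms by (auto simp: greatest_def Lower_def)
qed

lemma least_pairI:
  assumes "s \<in> carrier L" "x \<in> carrier L" "y \<in> carrier L" "le L x s" "le L y s"
    and "\<And>t. t \<in> carrier L \<Longrightarrow> le L x t \<Longrightarrow> le L y t \<Longrightarrow> le L s t"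
  shows "least L s (Upper L {x, y})"
  using assms by (auto simp: least_def Upper_def)

lemma greatest_pairI:
  assumes "s \<in> carrier L" "x \<in> carrier L" "y \<in> carrier L" "le L s x" "le L s y"
    and "\<And>t. t \<in> carrier L \<Longrightarrow> le L t x \<Longrightarrow> le L t y \<Longrightarrow> le L t s"
  shows "greatest L s (Lower L {x, y})"
  using assms by (auto simp: greatest_def Lower_def)

lemma proj_order_antisym:
  assumes "u \<in> carrier proj_order" "v \<in> carrier proj_order"
    "le proj_order u v" "le proj_order v u"
  shows "u = v"
  using assms projections_le_sym[of u v] by (simp add: proj_order_def)

lemma proj_order_join:
  assumes "p \<in> projections" "q \<in> projections"
  shows "p \<squnion>\<^bsub>proj_order\<^esub> q = pjoin p q"
proof (rule least_antisym_eq_sup[OF least_pairI proj_order_antisym])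
  show "le proj_order (pjoin p q) t" if "le proj_order p t" "le proj_order q t" for t
    using that pjoin_least[OF assms, of t] by (simp add: proj_order_def)
qed (use assms pjoin_projection pjoin_upper[OF assms] in \<open>simp_all add: proj_order_def\<close>)

lemma proj_order_meet:
  assumes "p \<in> projections" "q \<in> projections"
  shows "p \<sqinter>\<^bsub>proj_order\<^esub> q = pmeet p q"
proof (rule greatest_antisym_eq_inf[OF greatest_pairI proj_order_antisym])
  show "le proj_order t (pmeet p q)" if "le proj_order t p" "le proj_order t q" for t
    using that pmeet_fix[OF assms, of t] by (simp add: proj_order_def)
qed (use assms pmeet_projection pmeet_lower[OF assms] in \<open>simp_all add: proj_order_def\<close>)

section \<open>Moore-Penrose inverses and one-sided projections\<close>

lemma is_mp_inverse_mp_inverse: "is_mp_inverse a (a\<^sup>\<dagger>)"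
  unfolding mp_inverse_def by (rule theI'[OF mp_inverse_ex1])

lemma mp_inverse_mult_eq_rp: "a\<^sup>\<dagger> * a = rp a"
proof (rule rp_eqI[symmetric])
  note mp = is_mp_inverse_mp_inverse[of a, unfolded is_mp_inverse_def]
  show "a\<^sup>\<dagger> * a \<in> projections"
    using mp by (simp add: projections_def flip: mult.assoc)
  show "a * x = 0 \<longleftrightarrow> a\<^sup>\<dagger> * a * x = 0" for x
    using mp by (metis mult.assoc mult_zero_right)
qed

text \<open>\<open>star a\<close> and \<open>a * a\<^sup>\<dagger>\<close> are left multiples of
  each other, hence have the same right annihilator.\<close>

lemma mult_mp_inverse_eq_lp: "a * a\<^sup>\<dagger> = lp a"
  unfolding lp_eq_rp_star
proof (rule rp_eqI[symmetric])
  note mp = is_mp_inverse_mp_inverse[of a, unfolded is_mp_inverse_def]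
  show "a * a\<^sup>\<dagger> \<in> projections"
    using mp by (simp add: projections_def flip: mult.assoc)
  have "star (a * a\<^sup>\<dagger> * a) = star a" "star (a * a\<^sup>\<dagger>) = a * a\<^sup>\<dagger>" using mp by auto
  then have "star a = star a * (a * a\<^sup>\<dagger>)" "a * a\<^sup>\<dagger> = star (a\<^sup>\<dagger>) * star a"
    by (simp_all add: star_mult)
  then show "star a * x = 0 \<longleftrightarrow> a * a\<^sup>\<dagger> * x = 0" for x
    by (metis mult.assoc mult_zero_right)
qed


section \<open>The orders in terms of right projections\<close>

text \<open>For \<open>p \<le> rp b\<close> the conditions that \<^term>\<open>b * p\<close> has to satisfy besides
  the right star relation all take the form \<open>p * h = p * h * p\<close>; these are the
  elements \<open>h\<close>.\<close>

fun side_ops :: "side \<Rightarrow> 'a::rickart_star_ring \<Rightarrow> 'a set" where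
  "side_ops Left_square b = {b}"
| "side_ops Right_square b = {star b * rp b}"
| "side_ops Square b = {b, star b * rp b}"

text \<open>\<open>star b * b\<close> encodes \<open>lp a * b = a\<close>. The right star relation
  is already captured by \<open>a = b * rp a\<close> and rp a \<le> rp b. \<open>Left_star\<close>
  shares the empty default and is excluded where the order is translated.\<close>

fun base_ops :: "base \<Rightarrow> 'a::rickart_star_ring \<Rightarrow> 'a set" where
  "base_ops Star b = {star b * b}"
| "base_ops _ b = {}"

definition admissible :: "base \<Rightarrow> side \<Rightarrow> 'a::rickart_star_ring \<Rightarrow> 'a \<Rightarrow> bool" where
  "admissible \<beta> \<sigma> b p \<longleftrightarrow> p \<in> projections \<and> p * rp b = p \<and>
     (\<forall>h \<in> base_ops \<beta> b \<union> side_ops \<sigma> b. p * h * p = p * h)"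

text \<open>As p \<le> rp b, the annihilator of \<open>b\<close> sees \<open>p * x\<close> as
  \<open>rp b * p * x = p * x\<close>. Thus \<open>rp\<close> recovers \<open>p\<close> from
  \<open>b * p\<close>.\<close>

lemma rp_mult_admissible:
  assumes "admissible \<beta> \<sigma> b p"
  shows "rp (b * p) = p"
proof (rule rp_eqI)
  show p: "p \<in> projections" using assms by (simp add: admissible_def)
  have "rp b * p = p"
    using assms projections_le_sym[OF p rp_projection[of b]] by (simp add: admissible_def)
  then show "b * p * x = 0 \<longleftrightarrow> p * x = 0" for x
    using rp_mult_eq_0_iff[of b "p * x"] by (simp flip: mult.assoc)
qed

lemma left_square_iff:
  assumes "a = b * rp a"
  shows "a * a = a * b \<longleftrightarrow> rp a * b * rp a = rp a * b"
  using rp_mult_cancel[of a a b] assms by (metis mult.assoc)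

text \<open>Substituting \<open>a = b * rp a\<close> puts a factor \<open>b\<close> on the left of
  both sides; it cancels to \<open>rp b\<close>. Taking adjoints then moves the condition to the
  form \<open>p * h * p = p * h\<close>.\<close>

lemma right_square_iff:
  assumes a: "a = b * rp a" and le: "rp b * rp a = rp a"
  shows "a * a = b * a \<longleftrightarrow> rp a * (star b * rp b) * rp a = rp a * (star b * rp b)"
proof -
  have "a * a = b * a \<longleftrightarrow> b * (rp a * b * rp a) = b * (b * rp a)"
    using a by (metis mult.assoc)
  also have "\<dots> \<longleftrightarrow> rp b * (rp a * b * rp a) = rp b * (b * rp a)"
    by (simp only: rp_mult_cancel)
  also have "\<dots> \<longleftrightarrow> rp a * b * rp a = rp b * b * rp a"
    using le by (simp flip: mult.assoc)
  also have "\<dots> \<longleftrightarrow> rp a * star b * rp a = rp a * star b * rp b"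
    by (subst star_cancel[symmetric]) (simp add: star_mult mult.assoc)
  also have "\<dots> \<longleftrightarrow> rp a * (star b * rp b) * rp a = rp a * (star b * rp b)"
    using le by (simp add: mult.assoc)
  finally show ?thesis .
qed

text \<open>Since \<open>lp a * a = a\<close>, the left side reads
  \<open>lp a * b = lp a * a\<close>. Replacing \<open>lp a = rp (star a)\<close> by
  \<open>star a\<close> and expanding \<open>star a = rp a * star b\<close> gives the right
  side.\<close>

lemma star_base_iff:
  assumes "a = b * rp a"
  shows "lp a * b = a \<longleftrightarrow> rp a * (star b * b) * rp a = rp a * (star b * b)"
proof -
  have sa: "star a = rp a * star b" using arg_cong[OF assms, of star] by (simp add: star_mult)
  have "lp a * a = a"
    by (subst star_cancel[symmetric]) (simp add: lp_eq_rp_star star_mult)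
  then have "lp a * b = a \<longleftrightarrow> lp a * b = lp a * a" by simp
  also have "\<dots> \<longleftrightarrow> star a * b = star a * a"
    unfolding lp_eq_rp_star by (rule rp_mult_cancel)
  also have "\<dots> \<longleftrightarrow> rp a * (star b * b) = rp a * (star b * b) * rp a"
    using assms unfolding sa by (metis mult.assoc)
  finally show ?thesis by auto
qed

abbreviation star_le :: "base \<Rightarrow> side \<Rightarrow> 'a::rickart_star_ring \<Rightarrow> 'a \<Rightarrow> bool" where
  "star_le \<beta> \<sigma> a b \<equiv> base_le \<beta> a b \<and> side_cond \<sigma> a b"

text \<open>Both sides force \<open>a = b * rp a\<close> and \<open>a * rp b = a\<close>. Under
  these equations the preceding equivalences translate each remaining condition, so order questions
  become questions about projections.\<close>

lemma star_le_iff_admissible: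
  assumes \<beta>: "\<beta> \<noteq> Left_star"
  shows "star_le \<beta> \<sigma> a b \<longleftrightarrow> a = b * rp a \<and> admissible \<beta> \<sigma> b (rp a)"
proof (cases "a = b * rp a \<and> a * rp b = a")
  case True
  then have a: "a = b * rp a" and le: "rp a * rp b = rp a" by (simp_all add: rp_le_iff)
  then have le': "rp b * rp a = rp a" by (metis projections_le_sym rp_projection)
  have "base_le \<beta> a b \<longleftrightarrow> (\<forall>h \<in> base_ops \<beta> b. rp a * h * rp a = rp a * h)"
    using \<beta> True star_base_iff[OF a] by (cases \<beta>) auto
  moreover have "side_cond \<sigma> a b \<longleftrightarrow> (\<forall>h \<in> side_ops \<sigma> b. rp a * h * rp a = rp a * h)"
    using left_square_iff[OF a] right_square_iff[OF a le']
    by (cases \<sigma>) (auto simp: power2_eq_square)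
  ultimately show ?thesis using a le by (auto simp: admissible_def)
next
  case False
  \<comment> \<open>The base \<open>Star\<close> does not list this equation; it is inherited from
    \<open>b * rp b = b\<close>.\<close>
  have "a * rp b = a" if "lp a * b = a"
    using that mult_rp[of b] by (metis mult.assoc)
  then have "\<not> base_le \<beta> a b" using False \<beta> by (cases \<beta>) auto
  moreover have "\<not> (a = b * rp a \<and> admissible \<beta> \<sigma> b (rp a))"
    using False by (auto simp: admissible_def rp_le_iff)
  ultimately show ?thesis by blast
qed

section \<open>Closure of admissible projections under join and meet\<close>

text \<open>With s = p \<or> q, the goal is \<open>s * (h * s - h) = 0\<close>, which need only be
  checked with \<open>p\<close> and \<open>q\<close> in front. There
  \<open>p * h * s = p * h * p * s = p * h\<close>, and likewise for \<open>q\<close>.\<close>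

lemma admissible_pjoin:
  assumes "admissible \<beta> \<sigma> b p" "admissible \<beta> \<sigma> b q"
  shows "admissible \<beta> \<sigma> b (pjoin p q)"
proof -
  have pq: "p \<in> projections" "q \<in> projections" using assms by (auto simp: admissible_def)
  define s where "s = pjoin p q"
  have "s * h * s = s * h" if h: "h \<in> base_ops \<beta> b \<union> side_ops \<sigma> b" for h
  proof -
    have "p * h * p = p * h" "q * h * q = q * h" using assms h by (auto simp: admissible_def)
    moreover have "p * s = p" "q * s = q" by (simp_all add: s_def pjoin_upper pq)
    ultimately have "p * h * s = p * h" "q * h * s = q * h" by (metis mult.assoc)+
    then have "p * (h * s - h) = 0" "q * (h * s - h) = 0" by (simp_all add: algebra_simps)
    then have "s * (h * s - h) = 0" unfolding s_def by (rule pjoin_mult_eq_0[OF pq])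
    then show ?thesis by (simp add: algebra_simps)
  qed
  then show ?thesis
    using assms pjoin_projection[OF pq] pjoin_least[OF pq, of "rp b"]
    by (simp add: admissible_def s_def)
qed

text \<open>As \<open>m\<close> lies below \<open>p\<close> and \<open>q\<close>, the element
  \<open>m * h\<close> is fixed by right multiplication with both, hence with their meet.\<close>

lemma admissible_pmeet:
  assumes "admissible \<beta> \<sigma> b p" "admissible \<beta> \<sigma> b q"
  shows "admissible \<beta> \<sigma> b (pmeet p q)"
proof -
  have pq: "p \<in> projections" "q \<in> projections" using assms by (auto simp: admissible_def)
  define m where "m = pmeet p q"
  have le: "m * p = m" "m * q = m" by (simp_all add: m_def pmeet_lower pq)
  have "m * h * m = m * h" if h: "h \<in> base_ops \<beta> b \<union> side_ops \<sigma> b" for h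
  proof -
    have "p * h * p = p * h" "q * h * q = q * h" using assms h by (auto simp: admissible_def)
    then have "m * h * p = m * h" "m * h * q = m * h" using le by (metis mult.assoc)+
    then show ?thesis unfolding m_def by (rule pmeet_fix[OF pq])
  qed
  moreover have "m * rp b = m" using assms le by (metis admissible_def mult.assoc)
  ultimately show ?thesis
    using pmeet_projection[OF pq] by (simp add: admissible_def m_def)
qed

lemma star_le_admissible:
  assumes "\<beta> \<noteq> Left_star" "admissible \<beta> \<sigma> b p"
  shows "star_le \<beta> \<sigma> (b * p) b"
  using assms by (simp add: star_le_iff_admissible rp_mult_admissible)

lemma admissible_compress:
  assumes p: "admissible \<beta> \<sigma> b p" and r: "r \<in> projections" "r * p = r"
  shows "admissible \<beta> \<sigma> (b * p) r \<longleftrightarrow> admissible \<beta> \<sigma> b r"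
proof -
  have pp: "star p = p" "p * p = p" "p * rp b = p"
    using p by (auto simp: admissible_def projectionsD)
  have rb: "r * rp b = r" using r pp by (metis mult.assoc)
  have pr: "p * r = r" using p r projections_le_sym[of r p] by (simp add: admissible_def)
  \<comment> \<open>The conditions only involve the compressions \<open>p * h * p\<close>, which agree for
    \<^term>\<open>b\<close> and \<^term>\<open>b * p\<close>.\<close>
  have eq: "r * k * r = r * k \<longleftrightarrow> r * h * r = r * h"
    if "p * h * p = p * h" "r * k = r * (p * h * p)" for h k
    using that r by (metis mult.assoc)
  have rpp: "rp b * p = p" using projections_le_sym[of p "rp b"] p by (simp add: admissible_def)
  have 1: "r * (b * p) = r * (p * b * p)" using r by (simp flip: mult.assoc)
  \<comment> \<open>Here \<open>rp (b * p) = p\<close>, and \<open>rp b * p = p\<close> lets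
    \<open>rp b\<close> be inserted, so both sides reduce to \<open>r * star b * p\<close>.\<close>
  have 2: "r * (star (b * p) * rp (b * p)) = r * (p * (star b * rp b) * p)"
    using pp rpp by (simp add: rp_mult_admissible[OF p] star_mult mult.assoc)
  have 3: "r * (star (b * p) * (b * p)) = r * (p * (star b * b) * p)"
    by (simp add: star_mult pp mult.assoc)
  have H: "p * h * p = p * h" if "h \<in> base_ops \<beta> b \<union> side_ops \<sigma> b" for h
    using p that by (auto simp: admissible_def)
  have "(\<forall>h \<in> base_ops \<beta> (b * p). r * h * r = r * h) \<longleftrightarrow>
        (\<forall>h \<in> base_ops \<beta> b. r * h * r = r * h)"
    using eq[OF _ 3] H by (cases \<beta>) auto
  moreover have "(\<forall>h \<in> side_ops \<sigma> (b * p). r * h * r = r * h) \<longleftrightarrow>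
        (\<forall>h \<in> side_ops \<sigma> b. r * h * r = r * h)"
    using eq[OF _ 1] eq[OF _ 2] H by (cases \<sigma>) auto
  ultimately show ?thesis
    using r rb by (auto simp: admissible_def rp_mult_admissible[OF p])
qed

text \<open>If rp d \<le> rp a, then \<open>a * rp d = b * rp d\<close> and admissibility for
  \<open>a\<close> and for \<open>b\<close> agree by compression. Otherwise both sides fail. Below
  \<open>b\<close> the order is thus that of right projections.\<close>

lemma star_le_below_iff:
  assumes \<beta>: "\<beta> \<noteq> Left_star" and ab: "star_le \<beta> \<sigma> a b"
  shows "star_le \<beta> \<sigma> d a \<longleftrightarrow> star_le \<beta> \<sigma> d b \<and> rp d * rp a = rp d"
proof (cases "rp d * rp a = rp d")
  case True
  then have "rp a * rp d = rp d" by (metis projections_le_sym rp_projection)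
  moreover have a: "a = b * rp a" "admissible \<beta> \<sigma> b (rp a)"
    using ab star_le_iff_admissible[OF \<beta>] by blast+
  ultimately have "a * rp d = b * rp d" by (metis mult.assoc)
  moreover have "admissible \<beta> \<sigma> a (rp d) \<longleftrightarrow> admissible \<beta> \<sigma> b (rp d)"
    using admissible_compress[OF a(2) rp_projection True] a(1) by simp
  ultimately show ?thesis using True by (simp add: star_le_iff_admissible[OF \<beta>])
next
  case False
  then show ?thesis by (auto simp: star_le_iff_admissible[OF \<beta>] admissible_def)
qed

lemma star_order_simps [simp]:
  "carrier (star_order \<beta> \<sigma>) = UNIV"
  "le (star_order \<beta> \<sigma>) = (\<lambda>a b. star_le \<beta> \<sigma> a b)"
  by (simp_all add: star_order_def)

lemma right_star_antisym:
  assumes \<beta>: "\<beta> \<noteq> Left_star" and ab: "star_le \<beta> \<sigma> a b" and ba: "star_le \<beta> \<sigma> b a"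
  shows "a = b"
proof -
  have "a = b * rp a" using ab star_le_iff_admissible[OF \<beta>] by blast
  moreover have "b * rp a = b"
    using ba by (simp add: star_le_iff_admissible[OF \<beta>] admissible_def rp_le_iff)
  ultimately show ?thesis by simp
qed

section \<open>Suprema and infima for the bases r* and *\<close>

context
  fixes \<beta> \<sigma> and a1 a2 b :: "'a::rickart_star_ring"
  assumes \<beta>: "\<beta> \<noteq> Left_star"
    and a1: "star_le \<beta> \<sigma> a1 b" and a2: "star_le \<beta> \<sigma> a2 b"
begin

lemma right_star_least:
  "least (star_order \<beta> \<sigma>) (b * pjoin (rp a1) (rp a2)) (Upper (star_order \<beta> \<sigma>) {a1, a2})"
proof (rule least_pairI; (simp only: star_order_simps UNIV_I)?)
  let ?p = "pjoin (rp a1) (rp a2)"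
  have adm: "admissible \<beta> \<sigma> b ?p"
    using a1 a2 by (intro admissible_pjoin) (simp_all add: star_le_iff_admissible[OF \<beta>])
  note le_b = star_le_admissible[OF \<beta> adm]
  show "star_le \<beta> \<sigma> a1 (b * ?p)" "star_le \<beta> \<sigma> a2 (b * ?p)"
    using a1 a2 pjoin_upper[of "rp a1" "rp a2"]
    unfolding star_le_below_iff[OF \<beta> le_b] by (simp_all add: rp_mult_admissible[OF adm])
  \<comment> \<open>No relation between \<open>c\<close> and \<open>b\<close> is given. The join is
    admissible for \<open>c\<close> as well, and \<open>c * ?p = b * ?p\<close> because both
    elements act alike on \<open>rp a1\<close> and \<open>rp a2\<close>.\<close>
  fix c assume c: "star_le \<beta> \<sigma> a1 c" "star_le \<beta> \<sigma> a2 c"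
  then have "admissible \<beta> \<sigma> c ?p"
    by (intro admissible_pjoin) (simp_all add: star_le_iff_admissible[OF \<beta>])
  then have "star_le \<beta> \<sigma> (c * ?p) c" by (rule star_le_admissible[OF \<beta>])
  moreover have "(c - b) * ?p = 0"
  proof (rule mult_pjoin_eq_0)
    have "c * rp a1 = a1" "c * rp a2 = a2" "b * rp a1 = a1" "b * rp a2 = a2"
      using a1 a2 c star_le_iff_admissible[OF \<beta>] by metis+
    then show "(c - b) * rp a1 = 0" "(c - b) * rp a2 = 0" by (simp_all add: algebra_simps)
  qed simp_all
  ultimately show "star_le \<beta> \<sigma> (b * ?p) c" by (simp add: algebra_simps)
qed

lemma right_star_greatest:
  "greatest (star_order \<beta> \<sigma>) (b * pmeet (rp a1) (rp a2)) (Lower (star_order \<beta> \<sigma>) {a1, a2})"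
proof (rule greatest_pairI; (simp only: star_order_simps UNIV_I)?)
  let ?p = "pmeet (rp a1) (rp a2)"
  have adm: "admissible \<beta> \<sigma> b ?p"
    using a1 a2 by (intro admissible_pmeet) (simp_all add: star_le_iff_admissible[OF \<beta>])
  note le_b = star_le_admissible[OF \<beta> adm]
  show "star_le \<beta> \<sigma> (b * ?p) a1" "star_le \<beta> \<sigma> (b * ?p) a2"
    using le_b pmeet_lower[of "rp a1" "rp a2"]
    unfolding star_le_below_iff[OF \<beta> a1] star_le_below_iff[OF \<beta> a2]
    by (simp_all add: rp_mult_admissible[OF adm])
  \<comment> \<open>A lower bound of \<open>a1\<close> lies below \<open>b\<close>, so only right
    projections remain to be compared.\<close>
  fix d assume "star_le \<beta> \<sigma> d a1" "star_le \<beta> \<sigma> d a2"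
  then have d: "star_le \<beta> \<sigma> d b" "rp d * rp a1 = rp d" "rp d * rp a2 = rp d"
    using star_le_below_iff[OF \<beta> a1] star_le_below_iff[OF \<beta> a2] by blast+
  then have "rp d * ?p = rp d" by (intro pmeet_fix) simp_all
  then show "star_le \<beta> \<sigma> d (b * ?p)"
    using d unfolding star_le_below_iff[OF \<beta> le_b] by (simp add: rp_mult_admissible[OF adm])
qed

end


section \<open>Left star orders by duality\<close>

text \<open>The involution reverses products and so exchanges the conditions
  \<open>a * a = a * b\<close> and \<open>a * a = b * a\<close>.\<close>

fun opp :: "side \<Rightarrow> side" where
  "opp Left_square = Right_square"
| "opp Right_square = Left_square"
| "opp Square = Square"

lemma left_star_iff:
  "star_le Left_star \<sigma> a b \<longleftrightarrow> star_le Right_star (opp \<sigma>) (star a) (star b)"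
proof -
  have "lp a * b = a \<longleftrightarrow> star a = star b * rp (star a)"
    by (subst star_cancel[symmetric]) (auto simp: lp_eq_rp_star star_mult)
  moreover have "a = lp b * a \<longleftrightarrow> star a * rp (star b) = star a"
    by (subst star_cancel[symmetric]) (auto simp: lp_eq_rp_star star_mult)
  moreover have "x * y = u * v \<longleftrightarrow> star y * star x = star v * star u" for x y u v :: 'a
    by (metis star_cancel star_mult)
  ultimately show ?thesis by (cases \<sigma>) (auto simp: power2_eq_square)
qed

lemma left_star_antisym:
  assumes "star_le Left_star \<sigma> a b" "star_le Left_star \<sigma> b a"
  shows "a = b"
proof -
  have "star a = star b"
    by (rule right_star_antisym[OF _ assms[unfolded left_star_iff]]) simp
  then show ?thesis by (simp only: star_cancel)
qed

text \<open>An upper bound \<open>t\<close> of \<open>x\<close> and \<open>y\<close> gives the upper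
  bound \<open>star t\<close> of the adjoints, where leastness of \<open>star s\<close>
  applies.\<close>

lemma left_star_least_dual:
  assumes "least (star_order Right_star (opp \<sigma>)) (star s)
    (Upper (star_order Right_star (opp \<sigma>)) {star x, star y})"
  shows "least (star_order Left_star \<sigma>) s (Upper (star_order Left_star \<sigma>) {x, y})"
  using assms unfolding least_def Upper_def star_order_simps left_star_iff by blast

lemma left_star_greatest_dual:
  assumes "greatest (star_order Right_star (opp \<sigma>)) (star s)
    (Lower (star_order Right_star (opp \<sigma>)) {star x, star y})"
  shows "greatest (star_order Left_star \<sigma>) s (Lower (star_order Left_star \<sigma>) {x, y})"
  using assms unfolding greatest_def Lower_def star_order_simps left_star_iff by blast

theorem theorem42:
  fixes a1 a2 b :: "'a::regular_rickart_star_ring" and \<beta> :: base and \<sigma> :: side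
  assumes "a1 \<sqsubseteq>\<^bsub>star_order \<beta> \<sigma>\<^esub> b"
    and "a2 \<sqsubseteq>\<^bsub>star_order \<beta> \<sigma>\<^esub> b"
  shows "(\<exists>s. least (star_order \<beta> \<sigma>) s (Upper (star_order \<beta> \<sigma>) {a1, a2})) \<and>
    (\<exists>i. greatest (star_order \<beta> \<sigma>) i (Lower (star_order \<beta> \<sigma>) {a1, a2})) \<and>
    (\<beta> \<in> {Right_star, Star} \<longrightarrow>
       a1 \<squnion>\<^bsub>star_order \<beta> \<sigma>\<^esub> a2 = b * (rp a1 \<squnion>\<^bsub>proj_order\<^esub> rp a2) \<and>
       a1 \<squnion>\<^bsub>star_order \<beta> \<sigma>\<^esub> a2 = b * ((a1\<^sup>\<dagger> * a1) \<squnion>\<^bsub>proj_order\<^esub> (a2\<^sup>\<dagger> * a2)) \<and>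
       a1 \<sqinter>\<^bsub>star_order \<beta> \<sigma>\<^esub> a2 = b * (rp a1 \<sqinter>\<^bsub>proj_order\<^esub> rp a2) \<and>
       a1 \<sqinter>\<^bsub>star_order \<beta> \<sigma>\<^esub> a2 = b * ((a1\<^sup>\<dagger> * a1) \<sqinter>\<^bsub>proj_order\<^esub> (a2\<^sup>\<dagger> * a2))) \<and>
    (\<beta> = Left_star \<longrightarrow>
       a1 \<squnion>\<^bsub>star_order \<beta> \<sigma>\<^esub> a2 = (lp a1 \<squnion>\<^bsub>proj_order\<^esub> lp a2) * b \<and>
       a1 \<squnion>\<^bsub>star_order \<beta> \<sigma>\<^esub> a2 = ((a1 * a1\<^sup>\<dagger>) \<squnion>\<^bsub>proj_order\<^esub> (a2 * a2\<^sup>\<dagger>)) * b \<and>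
       a1 \<sqinter>\<^bsub>star_order \<beta> \<sigma>\<^esub> a2 = (lp a1 \<sqinter>\<^bsub>proj_order\<^esub> lp a2) * b \<and>
       a1 \<sqinter>\<^bsub>star_order \<beta> \<sigma>\<^esub> a2 = ((a1 * a1\<^sup>\<dagger>) \<sqinter>\<^bsub>proj_order\<^esub> (a2 * a2\<^sup>\<dagger>)) * b)"
proof (cases "\<beta> = Left_star")
  case False
  then have a: "star_le \<beta> \<sigma> a1 b" "star_le \<beta> \<sigma> a2 b" using assms by simp_all
  note s = right_star_least[OF False a] and i = right_star_greatest[OF False a]
  have "a1 \<squnion>\<^bsub>star_order \<beta> \<sigma>\<^esub> a2 = b * pjoin (rp a1) (rp a2)"
    by (rule least_antisym_eq_sup[OF s]) (use right_star_antisym[OF False] in simp)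
  moreover have "a1 \<sqinter>\<^bsub>star_order \<beta> \<sigma>\<^esub> a2 = b * pmeet (rp a1) (rp a2)"
    by (rule greatest_antisym_eq_inf[OF i]) (use right_star_antisym[OF False] in simp)
  ultimately show ?thesis
    using s i False by (auto simp: proj_order_join proj_order_meet mp_inverse_mult_eq_rp)
next
  case True
  have a: "star_le Right_star (opp \<sigma>) (star a1) (star b)"
    "star_le Right_star (opp \<sigma>) (star a2) (star b)"
    using assms unfolding True star_order_simps left_star_iff by auto
  have lp [simp]: "lp x \<in> projections" for x :: 'a by (simp add: lp_eq_rp_star)
  \<comment> \<open>Self-adjointness turns \<open>star (pjoin (lp a1) (lp a2) * b)\<close> into
    \<open>star b\<close> times the same join, the shape of the right-sided result.\<close>
  have j: "star (pjoin (lp a1) (lp a2)) = pjoin (lp a1) (lp a2)"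
    and m: "star (pmeet (lp a1) (lp a2)) = pmeet (lp a1) (lp a2)"
    by (intro projectionsD pjoin_projection pmeet_projection lp)+
  have s: "least (star_order \<beta> \<sigma>) (pjoin (lp a1) (lp a2) * b) (Upper (star_order \<beta> \<sigma>) {a1, a2})"
    unfolding True using right_star_least[OF _ a]
    by (intro left_star_least_dual) (simp add: star_mult j, simp add: lp_eq_rp_star)
  have i: "greatest (star_order \<beta> \<sigma>) (pmeet (lp a1) (lp a2) * b) (Lower (star_order \<beta> \<sigma>) {a1, a2})"
    unfolding True using right_star_greatest[OF _ a]
    by (intro left_star_greatest_dual) (simp add: star_mult m, simp add: lp_eq_rp_star)
  have "a1 \<squnion>\<^bsub>star_order \<beta> \<sigma>\<^esub> a2 = pjoin (lp a1) (lp a2) * b"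
    by (rule least_antisym_eq_sup[OF s]) (unfold True star_order_simps, rule left_star_antisym)
  moreover have "a1 \<sqinter>\<^bsub>star_order \<beta> \<sigma>\<^esub> a2 = pmeet (lp a1) (lp a2) * b"
    by (rule greatest_antisym_eq_inf[OF i]) (unfold True star_order_simps, rule left_star_antisym)
  ultimately show ?thesis
    using s i True by (auto simp: proj_order_join proj_order_meet mult_mp_inverse_eq_lp)
qed

end
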